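(* Let $E$ be an f-BC and let $\widetilde{E}$ be the universal cover of $E$ at $e\in E$. Then $\widetilde{E}$ is simply connected.
   Context: Let $G=\langle g\rangle$ be a fixed infinite cyclic group. A fractional Brauer configuration (f-BC) is a quadruple $E=(E,P,L,d)$, where $E$ is a $G$-set, $P$ and $L$ are two partitions of $E$ (write $P(e)$, $L(e)$ for the classes containing $e\in E$), and $d:E\to\mathbb{Z}_{>0}$ is a function, such that: (f1) $L(e)\subseteq P(e)$ and $P(e)$ is a finite set for each $e\in E$; (f2) if $L(e_1)=L(e_2)$, then $P(g\cdot e_1)=P(g\cdot e_2)$; (f3) if $e_1,e_2$ belong to the same $G$-orbit, then $d(e_1)=d(e_2)$; (f4) $P(e_1)=P(e_2)$ if and only if $P(g^{d(e_1)}\cdot e_1)=P(g^{d(e_2)}\cdot e_2)$; (f5) $L(e_1)=L(e_2)$ if and only if $L(g^{d(e_1)}\cdot e_1)=L(g^{d(e_2)}\cdot e_2)$; (f6) the sequence $L(g^{d(e)-1}\cdot e)\cdots L(g\cdot e)L(e)$ is not a proper subsequence (block of consecutive terms) of $L(g^{d(h)-1}\cdot h)\cdots L(g\cdot h)L(h)$ for all $e,h\in E$. A walk of $E$ is a sequence $w=(e_n|\delta_n|e_{n-1})\cdots(e_1|\delta_1|e_0)$ with $e_i\in E$, $\delta_i\in\{g,g^{-1},\tau\}$, such that $e_i=g\cdot e_{i-1}$ if $\delta_i=g$, $e_i=g^{-1}\cdot e_{i-1}$ if $\delta_i=g^{-1}$, $P(e_i)=P(e_{i-1})$ if $\delta_i=\tau$;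 abbreviated $(e_n|\delta_n\cdots\delta_1|e_0)$; $s(w)=e_0$, $t(w)=e_n$; $(e||e)$ is the trivial walk. Composition $uv$ is concatenation when $t(v)=s(u)$. $E$ is connected if any two elements can be connected by a walk. Homotopy $\sim$ is the smallest equivalence relation on walks with: (h1) $(e|g^{-1}g|e)\sim(e|gg^{-1}|e)\sim(e|\tau|e)\sim(e||e)$; (h2) $(e_2|\tau|e_1)(e_1|\tau|e_0)\sim(e_2|\tau|e_0)$; (h3) $(g^{d(h)}\cdot h|\tau|g^{d(e)}\cdot e)(g^{d(e)}\cdot e|g^{d(e)}|e)\sim(g^{d(h)}\cdot h|g^{d(h)}|h)(h|\tau|e)$ whenever $P(e)=P(h)$; (h4) $(g\cdot h|\tau|g\cdot e)(g\cdot e|g|e)\sim(g\cdot h|g|h)(h|\tau|e)$ whenever $L(e)=L(h)$; (h5) compatibility with composition on both sides. $\overline{w}$ is the homotopy class of $w$, and $\Pi(E,e)$ is the group of homotopy classes of closed walks at $e$. A connected f-BC is simply connected if its fundamental group (independent of the base point up to isomorphism) is trivial. The universal cover of $E$ at $e\in E$ is the f-BC $\widetilde{E}=(\widetilde{E},\widetilde{P},\widetilde{L},\widetilde{d})$ with $\widetilde{E}=\{\overline{w}\mid s(w)=e\}$, $g^n\cdot\overline{w}=\overline{(g^n\cdot t(w)|g^n|t(w))w}$, $\widetilde{P}(\overline{w})=\{\overline{(h|\tau|t(w))w}\mid h\in P(t(w))\}$, $\widetilde{L}(\overline{w})=\{\overline{(h|\tau|t(w))w}\mid h\in L(t(w))\}$,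 $\widetilde{d}(\overline{w})=d(t(w))$. *)

theory Defs
  imports
    "HOL-Algebra.Group_Action"
    "HOL-Algebra.Elementary_Groups"
    "HOL-Library.Disjoint_Sets"
    "HOL-Library.Sublist"
begin

section \<open>Fractional Brauer configurations\<close>

text \<open>
  The fixed infinite cyclic group \<open>G = \<langle>g\<rangle>\<close> is \<^const>\<open>integer_group\<close> with generator \<open>g = 1\<close>.
  It is written additively, so that \<open>g\<^sup>n \<cdot> e\<close> is \<open>act E n e\<close>.
\<close>

record 'a brauer_config =
  points :: "'a set"
  act :: "int \<Rightarrow> 'a \<Rightarrow> 'a"
  P_part :: "'a set set"
  L_part :: "'a set set"
  deg :: "'a \<Rightarrow> nat"

definition part_class :: "'a set set \<Rightarrow> 'a \<Rightarrow> 'a set" where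
  "part_class Q x = (THE X. X \<in> Q \<and> x \<in> X)"

abbreviation P_class :: "'a brauer_config \<Rightarrow> 'a \<Rightarrow> 'a set" where
  "P_class E \<equiv> part_class (P_part E)"

abbreviation L_class :: "'a brauer_config \<Rightarrow> 'a \<Rightarrow> 'a set" where
  "L_class E \<equiv> part_class (L_part E)"

text \<open>The sequence \<open>L(g\<^bsup>d(e)-1\<^esup> \<cdot> e) \<dots> L(g \<cdot> e) L(e)\<close>, in this order.\<close>

definition L_sequence :: "'a brauer_config \<Rightarrow> 'a \<Rightarrow> 'a set list" where
  "L_sequence E e = map (\<lambda>i. L_class E (act E (int i) e)) (rev [0..<deg E e])"

locale fBC = group_action integer_group "points E" "act E"
  for E :: "'a brauer_config" +
  assumes P_partition: "partition_on (points E) (P_part E)"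
    and L_partition: "partition_on (points E) (L_part E)"
    and deg_pos: "e \<in> points E \<Longrightarrow> 0 < deg E e"
    and f1: "e \<in> points E \<Longrightarrow> L_class E e \<subseteq> P_class E e \<and> finite (P_class E e)"
    and f2: "\<lbrakk>e1 \<in> points E; e2 \<in> points E; L_class E e1 = L_class E e2\<rbrakk>
      \<Longrightarrow> P_class E (act E 1 e1) = P_class E (act E 1 e2)"
    and f3: "\<lbrakk>e1 \<in> points E; e2 \<in> orbit integer_group (act E) e1\<rbrakk> \<Longrightarrow> deg E e1 = deg E e2"
    and f4: "\<lbrakk>e1 \<in> points E; e2 \<in> points E\<rbrakk> \<Longrightarrow>
      P_class E e1 = P_class E e2 \<longleftrightarrow>
      P_class E (act E (int (deg E e1)) e1) = P_class E (act E (int (deg E e2)) e2)"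
    and f5: "\<lbrakk>e1 \<in> points E; e2 \<in> points E\<rbrakk> \<Longrightarrow>
      L_class E e1 = L_class E e2 \<longleftrightarrow>
      L_class E (act E (int (deg E e1)) e1) = L_class E (act E (int (deg E e2)) e2)"
    and f6: "\<lbrakk>e \<in> points E; h \<in> points E\<rbrakk> \<Longrightarrow> \<not> strict_sublist (L_sequence E e) (L_sequence E h)"

section \<open>Walks\<close>

datatype letter = Gen | GenInv | Tau

text \<open>
  \<open>Triv e\<close> is the trivial walk \<open>(e||e)\<close>, and \<open>Step e' \<delta> w\<close> is \<open>(e'|\<delta>|t(w)) w\<close>. As in the usual
  notation, walks are read from right to left: the outermost step is the last one.
\<close>

datatype 'a walk = Triv 'a | Step 'a letter "'a walk"

primrec source :: "'a walk \<Rightarrow> 'a" where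
  "source (Triv e) = e"
| "source (Step e' \<delta> w) = source w"

primrec target :: "'a walk \<Rightarrow> 'a" where
  "target (Triv e) = e"
| "target (Step e' \<delta> w) = e'"

primrec admissible :: "'a brauer_config \<Rightarrow> 'a \<Rightarrow> letter \<Rightarrow> 'a \<Rightarrow> bool" where
  "admissible E e' Gen e \<longleftrightarrow> e' = act E 1 e"
| "admissible E e' GenInv e \<longleftrightarrow> e' = act E (-1) e"
| "admissible E e' Tau e \<longleftrightarrow> P_class E e' = P_class E e"

primrec is_walk :: "'a brauer_config \<Rightarrow> 'a walk \<Rightarrow> bool" where
  "is_walk E (Triv e) \<longleftrightarrow> e \<in> points E"
| "is_walk E (Step e' \<delta> w) \<longleftrightarrow> e' \<in> points E \<and> admissible E e' \<delta> (target w) \<and> is_walk E w"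

text \<open>The composition \<open>u v\<close>, meaningful when \<open>t(v) = s(u)\<close>: first \<open>v\<close>, then \<open>u\<close>.\<close>

primrec walk_comp :: "'a walk \<Rightarrow> 'a walk \<Rightarrow> 'a walk" (infixr \<open>\<odot>\<close> 70) where
  "Triv e \<odot> v = v"
| "Step e' \<delta> u \<odot> v = Step e' \<delta> (u \<odot> v)"

primrec pos_power_walk :: "'a brauer_config \<Rightarrow> nat \<Rightarrow> 'a \<Rightarrow> 'a walk" where
  "pos_power_walk E 0 e = Triv e"
| "pos_power_walk E (Suc k) e = Step (act E (int (Suc k)) e) Gen (pos_power_walk E k e)"

primrec neg_power_walk :: "'a brauer_config \<Rightarrow> nat \<Rightarrow> 'a \<Rightarrow> 'a walk" where
  "neg_power_walk E 0 e = Triv e"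
| "neg_power_walk E (Suc k) e = Step (act E (- int (Suc k)) e) GenInv (neg_power_walk E k e)"

text \<open>The walk \<open>(g\<^sup>n \<cdot> e|g\<^sup>n|e)\<close>, consisting of \<open>\<bar>n\<bar>\<close> steps.\<close>

definition power_walk :: "'a brauer_config \<Rightarrow> int \<Rightarrow> 'a \<Rightarrow> 'a walk" where
  "power_walk E n e =
    (if 0 \<le> n then pos_power_walk E (nat n) e else neg_power_walk E (nat (- n)) e)"

definition connected_config :: "'a brauer_config \<Rightarrow> bool" where
  "connected_config E \<longleftrightarrow>
    (\<forall>x\<in>points E. \<forall>y\<in>points E. \<exists>w. is_walk E w \<and> source w = x \<and> target w = y)"

section \<open>Homotopy and the fundamental group\<close>

inductive homotopic :: "'a brauer_config \<Rightarrow> 'a walk \<Rightarrow> 'a walk \<Rightarrow> bool" for E where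
  refl: "is_walk E w \<Longrightarrow> homotopic E w w"
| sym: "homotopic E u v \<Longrightarrow> homotopic E v u"
| trans: "\<lbrakk>homotopic E u v; homotopic E v w\<rbrakk> \<Longrightarrow> homotopic E u w"
| h1_inv_gen: "e \<in> points E \<Longrightarrow>
    homotopic E (Step e GenInv (Step (act E 1 e) Gen (Triv e))) (Triv e)"
| h1_gen_inv: "e \<in> points E \<Longrightarrow>
    homotopic E (Step e Gen (Step (act E (-1) e) GenInv (Triv e))) (Triv e)"
| h1_tau: "e \<in> points E \<Longrightarrow> homotopic E (Step e Tau (Triv e)) (Triv e)"
| h2: "\<lbrakk>e0 \<in> points E; e1 \<in> points E; e2 \<in> points E;
      P_class E e1 = P_class E e0; P_class E e2 = P_class E e1\<rbrakk> \<Longrightarrow>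
    homotopic E (Step e2 Tau (Step e1 Tau (Triv e0))) (Step e2 Tau (Triv e0))"
| h3: "\<lbrakk>e \<in> points E; h \<in> points E; P_class E e = P_class E h\<rbrakk> \<Longrightarrow>
    homotopic E
      (Step (act E (int (deg E h)) h) Tau (power_walk E (int (deg E e)) e))
      (power_walk E (int (deg E h)) h \<odot> Step h Tau (Triv e))"
| h4: "\<lbrakk>e \<in> points E; h \<in> points E; L_class E e = L_class E h\<rbrakk> \<Longrightarrow>
    homotopic E
      (Step (act E 1 h) Tau (Step (act E 1 e) Gen (Triv e)))
      (Step (act E 1 h) Gen (Step h Tau (Triv e)))"
| h5_left: "\<lbrakk>homotopic E u v; is_walk E w; source w = target u; source w = target v\<rbrakk> \<Longrightarrow>
    homotopic E (w \<odot> u) (w \<odot> v)"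
| h5_right: "\<lbrakk>homotopic E u v; is_walk E w; source u = target w; source v = target w\<rbrakk> \<Longrightarrow>
    homotopic E (u \<odot> w) (v \<odot> w)"

definition hclass :: "'a brauer_config \<Rightarrow> 'a walk \<Rightarrow> 'a walk set" where
  "hclass E w = {v. homotopic E w v}"

text \<open>
  Operations on homotopy classes are unions over representatives, as in
  \<^theory>\<open>HOL.Equiv_Relations\<close>: all members of such a union coincide, because the underlying
  operation on walks respects homotopy.
\<close>

definition fundamental_group :: "'a brauer_config \<Rightarrow> 'a \<Rightarrow> 'a walk set monoid" where
  "fundamental_group E e =
    \<lparr>carrier = {hclass E w | w. is_walk E w \<and> source w = e \<and> target w = e},
     monoid.mult = (\<lambda>U V. \<Union>u\<in>U. \<Union>v\<in>V. hclass E (u \<odot> v)),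
     one = hclass E (Triv e)\<rparr>"

definition simply_connected_fBC :: "'a brauer_config \<Rightarrow> bool" where
  "simply_connected_fBC E \<longleftrightarrow>
    fBC E \<and> connected_config E \<and> (\<forall>e\<in>points E. trivial_group (fundamental_group E e))"

section \<open>The universal cover\<close>

definition cover_points :: "'a brauer_config \<Rightarrow> 'a \<Rightarrow> 'a walk set set" where
  "cover_points E e = {hclass E w | w. is_walk E w \<and> source w = e}"

text \<open>The common target \<open>t(w)\<close> of the walks \<open>w\<close> in a homotopy class.\<close>

definition class_target :: "'a walk set \<Rightarrow> 'a" where
  "class_target W = the_elem (target ` W)"

text \<open>
  Elements of \<^const>\<open>Bij\<close>, in which group actions take their values, are
  extensional; hence the restriction to \<^const>\<open>cover_points\<close>.
\<close>

definition cover_act :: "'a brauer_config \<Rightarrow> 'a \<Rightarrow> int \<Rightarrow> 'a walk set \<Rightarrow> 'a walk set" where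
  "cover_act E e n =
    (\<lambda>W\<in>cover_points E e. \<Union>w\<in>W. hclass E (power_walk E n (target w) \<odot> w))"

text \<open>The homotopy class of \<open>(h|\<tau>|t(w)) w\<close>.\<close>

definition class_tau :: "'a brauer_config \<Rightarrow> 'a \<Rightarrow> 'a walk set \<Rightarrow> 'a walk set" where
  "class_tau E h W = (\<Union>w\<in>W. hclass E (Step h Tau w))"

definition cover_P :: "'a brauer_config \<Rightarrow> 'a walk set \<Rightarrow> 'a walk set set" where
  "cover_P E W = {class_tau E h W | h. h \<in> P_class E (class_target W)}"

definition cover_L :: "'a brauer_config \<Rightarrow> 'a walk set \<Rightarrow> 'a walk set set" where
  "cover_L E W = {class_tau E h W | h. h \<in> L_class E (class_target W)}"

definition universal_cover :: "'a brauer_config \<Rightarrow> 'a \<Rightarrow> 'a walk set brauer_config" where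
  "universal_cover E e =
    \<lparr>points = cover_points E e,
     act = cover_act E e,
     P_part = cover_P E ` cover_points E e,
     L_part = cover_L E ` cover_points E e,
     deg = (\<lambda>W. deg E (class_target W))\<rparr>"

end

theory Submission
  imports Defs
begin

text \<open>
  Axioms (f2)-(f5) pass to the cover by (h4) and (h3); (f6) does because projecting to targets maps the
  \<open>L\<close>-sequences of the cover onto those of \<open>E\<close>. Every walk of the cover starting at the class of \<open>w\<close> is
  the unique lift of its projection \<open>u\<close> to \<open>E\<close>, and this lift ends at the class of \<open>u w\<close>. So for a
  closed walk \<open>u w \<sim> w\<close>, whence \<open>u\<close> is null-homotopic; as every generating homotopy of \<open>E\<close> lifts, so
  is the closed walk itself.
\<close>

section \<open>Partitions and walks\<close>

text \<open>Points of the cover are sets of walks, and its action and partitions are unions and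
  images over such sets. The proof therefore fixes a representative \<open>w\<close> and turns every
  equality in the cover into a homotopy in \<open>E\<close>. Two obstacles shape it. (f4) and (f5)
  are equivalences: (h3) moves a tau-step across the power of \<open>g\<close>, but the converse
  also has to cancel that power, hence a calculus of power walks with exponents of both signs.
  Moreover (h3) needs targets in one P-class; for other targets (f4) of \<open>E\<close> makes both
  sides of the equivalence false. A closed walk of the cover may start at any class, so lifts start
  at a representative \<open>w\<close> rather than at the base point, and discarding
  \<open>w\<close> from \<open>u w \<sim> w\<close> means composing with the reverse of
  \<open>w\<close>. Lifting a homotopy requires the two lifts to end at the same point of the cover;
  that equality is the given homotopy in \<open>E\<close>, composed with \<open>w\<close>.\<close>

lemma part_class_eqI:
  assumes "partition_on A Q" "X \<in> Q" "x \<in> X"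
  shows "part_class Q x = X"
  unfolding part_class_def
  using assms by (intro the_equality) (auto simp: partition_on_def disjoint_def)

lemma part_class_mem:
  assumes "partition_on A Q" "x \<in> A"
  shows "x \<in> part_class Q x" "part_class Q x \<in> Q" "part_class Q x \<subseteq> A"
proof -
  obtain X where X: "X \<in> Q" "x \<in> X"
    using assms by (auto simp: partition_on_def)
  then have "part_class Q x = X"
    using assms(1) by (intro part_class_eqI)
  then show "x \<in> part_class Q x" "part_class Q x \<in> Q" "part_class Q x \<subseteq> A"
    using X assms(1) by (auto simp: partition_on_def)
qed

lemma part_class_eq_iff:
  assumes "partition_on A Q" "x \<in> A" "y \<in> A"
  shows "part_class Q x = part_class Q y \<longleftrightarrow> x \<in> part_class Q y"
  using assms part_class_mem part_class_eqI by metis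

text \<open>Meant for families of classes attached to points, as the cover defines them: two blocks
  with a common point both coincide with the class of that point.\<close>

lemma partition_on_classes:
  assumes "\<And>x. x \<in> A \<Longrightarrow> x \<in> C x" "\<And>x. x \<in> A \<Longrightarrow> C x \<subseteq> A"
    and "\<And>x y. x \<in> A \<Longrightarrow> y \<in> C x \<Longrightarrow> C y = C x"
  shows "partition_on A (C ` A)"
proof -
  have "p = q" if "p \<in> C ` A" "q \<in> C ` A" "x \<in> p" "x \<in> q" for p q x
    using that assms(3) by blast
  moreover have "\<Union> (C ` A) = A" "{} \<notin> C ` A"
    using assms(1,2) by blast+
  ultimately show ?thesis
    unfolding partition_on_def disjoint_def by blast
qed

lemma walk_comp_assoc: "(u \<odot> v) \<odot> w = u \<odot> v \<odot> w"
  by (induction u) auto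

lemma walk_comp_Triv: "x = source u \<Longrightarrow> u \<odot> Triv x = u"
  by (induction u) auto

lemma source_comp [simp]: "target v = source u \<Longrightarrow> source (u \<odot> v) = source v"
  by (induction u) auto

lemma target_comp [simp]: "target v = source u \<Longrightarrow> target (u \<odot> v) = target u"
  by (induction u) auto

lemma target_in_points: "is_walk E w \<Longrightarrow> target w \<in> points E"
  by (cases w) auto

lemma is_walk_comp [simp]:
  "target v = source u \<Longrightarrow> is_walk E (u \<odot> v) \<longleftrightarrow> is_walk E u \<and> is_walk E v"
  by (induction u) (auto simp: target_in_points)

lemma source_map_walk [simp]: "source (map_walk f w) = f (source w)"
  by (induction w) auto

lemma target_map_walk [simp]: "target (map_walk f w) = f (target w)"
  by (cases w) auto

primrec inv_letter :: "letter \<Rightarrow> letter" where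
  "inv_letter Gen = GenInv"
| "inv_letter GenInv = Gen"
| "inv_letter Tau = Tau"

primrec rev_walk :: "'a walk \<Rightarrow> 'a walk" where
  "rev_walk (Triv x) = Triv x"
| "rev_walk (Step x \<delta> w) = rev_walk w \<odot> Step (target w) (inv_letter \<delta>) (Triv x)"

lemma source_rev_walk [simp]: "source (rev_walk w) = target w"
  and target_rev_walk [simp]: "target (rev_walk w) = source w"
  by (induction w) auto

section \<open>Homotopy in a fractional Brauer configuration\<close>

context fBC
begin

lemma act_closed [simp]: "x \<in> points E \<Longrightarrow> act E n x \<in> points E"
  using element_image by simp

lemma act_act [simp]: "x \<in> points E \<Longrightarrow> act E m (act E n x) = act E (m + n) x"
  using composition_rule[of x m n] by simp

lemma act_0 [simp]: "x \<in> points E \<Longrightarrow> act E 0 x = x"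
  using id_eq_one by (metis one_integer_group restrict_apply')

lemmas P_mem = part_class_mem[OF P_partition]
lemmas P_eq_iff = part_class_eq_iff[OF P_partition]
lemmas L_eq_iff = part_class_eq_iff[OF L_partition]

lemma L_eq_imp_P_eq:
  "x \<in> points E \<Longrightarrow> y \<in> points E \<Longrightarrow> L_class E x = L_class E y \<Longrightarrow> P_class E x = P_class E y"
  using L_eq_iff[of x y] P_eq_iff[of x y] f1[of y] by blast

lemma pos_power_walk_props:
  "x \<in> points E \<Longrightarrow> is_walk E (pos_power_walk E k x) \<and> source (pos_power_walk E k x) = x
    \<and> target (pos_power_walk E k x) = act E (int k) x"
  by (induction k) (auto simp: algebra_simps)

lemma neg_power_walk_props:
  "x \<in> points E \<Longrightarrow> is_walk E (neg_power_walk E k x) \<and> source (neg_power_walk E k x) = x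
    \<and> target (neg_power_walk E k x) = act E (- int k) x"
  by (induction k) (auto simp: algebra_simps)

lemma power_walk_props [simp]:
  assumes "x \<in> points E"
  shows "is_walk E (power_walk E n x)" "source (power_walk E n x) = x"
    "target (power_walk E n x) = act E n x"
  using assms pos_power_walk_props neg_power_walk_props by (auto simp: power_walk_def)

lemma power_walk_0 [simp]: "power_walk E 0 x = Triv x"
  by (simp add: power_walk_def)

text \<open>Only (h3) and (h4) are not immediate: the tau-step after the powers of \<open>g\<close>
  is admissible by (f4) and (f2) respectively, and in (h4) the tau-step before them is admissible
  because L-classes lie inside P-classes.\<close>

lemma homotopic_props:
  "homotopic E u v \<Longrightarrow>
    is_walk E u \<and> is_walk E v \<and> source u = source v \<and> target u = target v"
proof (induction rule: homotopic.induct)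
  case (h3 e h)
  then show ?case using f4[of e h] by auto
next
  case (h4 e h)
  then show ?case using f2[of e h] L_eq_imp_P_eq[of e h] by auto
qed auto

lemma homotopic_source: "homotopic E u v \<Longrightarrow> source u = source v"
  and homotopic_target: "homotopic E u v \<Longrightarrow> target u = target v"
  using homotopic_props by blast+

section \<open>Composition and power walks up to homotopy\<close>

declare homotopic.trans [trans]

lemma homotopic_Step:
  assumes "homotopic E u v" "x \<in> points E" "admissible E x \<delta> (target u)"
  shows "homotopic E (Step x \<delta> u) (Step x \<delta> v)"
  using h5_left[OF assms(1), of "Step x \<delta> (Triv (target u))"] assms homotopic_props[OF assms(1)]
  by (simp add: target_in_points)

lemma homotopic_comp:
  assumes "homotopic E u u'" "homotopic E v v'" "source u = target v"
  shows "homotopic E (u \<odot> v) (u' \<odot> v')"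
proof -
  have "homotopic E (u \<odot> v) (u \<odot> v')"
    using assms homotopic_props by (intro h5_left) metis+
  also have "homotopic E \<dots> (u' \<odot> v')"
    using assms homotopic_props by (intro h5_right) metis+
  finally show ?thesis .
qed

lemma cancel_gen_inv:
  assumes "is_walk E w"
  shows "homotopic E (Step (target w) Gen (Step (act E (-1) (target w)) GenInv w)) w"
  using h5_right[OF h1_gen_inv assms] target_in_points[OF assms] by simp

lemma cancel_inv_gen:
  assumes "is_walk E w"
  shows "homotopic E (Step (target w) GenInv (Step (act E 1 (target w)) Gen w)) w"
  using h5_right[OF h1_inv_gen assms] target_in_points[OF assms] by simp

lemma cancel_tau:
  assumes "is_walk E w"
  shows "homotopic E (Step (target w) Tau w) w"
  using h5_right[OF h1_tau assms] target_in_points[OF assms] by simp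

lemma tau_tau:
  assumes "is_walk E w" "x \<in> points E" "y \<in> points E"
    "P_class E x = P_class E (target w)" "P_class E y = P_class E x"
  shows "homotopic E (Step y Tau (Step x Tau w)) (Step y Tau w)"
  using h5_right[OF h2 assms(1)] target_in_points[OF assms(1)] assms by simp

text \<open>For nonnegative \<open>n\<close> the two walks are equal; for negative \<open>n\<close>
  the new step cancels the last inverse step.\<close>

lemma power_walk_Gen:
  assumes "x \<in> points E"
  shows "homotopic E (Step (act E (n + 1) x) Gen (power_walk E n x)) (power_walk E (n + 1) x)"
proof (cases "0 \<le> n")
  case True
  then have "power_walk E (n + 1) x = Step (act E (n + 1) x) Gen (power_walk E n x)"
    by (simp add: power_walk_def nat_add_distrib add.commute[of 1 n])
  moreover have "act E 1 (act E n x) = act E (n + 1) x"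
    using assms by (simp only: act_act add.commute[of 1 n])
  then have "is_walk E (Step (act E (n + 1) x) Gen (power_walk E n x))"
    using assms by simp
  ultimately show ?thesis by (metis homotopic.refl)
next
  case False
  then obtain k where n: "n = - int (Suc k)"
    using not_le negD by blast
  have "n + 1 = - int k"
    by (simp add: n)
  \<comment> \<open>At \<open>k = 0\<close> the exponent falls into the nonnegative branch of
    \<open>power_walk\<close>; both branches give the trivial walk there.\<close>
  moreover have "power_walk E (- int k) x = neg_power_walk E k x"
    by (cases "k = 0") (auto simp: power_walk_def)
  ultimately show ?thesis
    using cancel_gen_inv[of "neg_power_walk E k x"] neg_power_walk_props[OF assms, of k] assms
    by (simp add: n power_walk_def nat_add_distrib)
qed

lemma power_walk_GenInv:
  assumes "x \<in> points E"
  shows "homotopic E (Step (act E (n - 1) x) GenInv (power_walk E n x)) (power_walk E (n - 1) x)"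
proof -
  let ?v = "power_walk E (n - 1) x"
  have "homotopic E (Step (act E n x) Gen ?v) (power_walk E n x)"
    using power_walk_Gen[OF assms, of "n - 1"] by simp
  then have "homotopic E (Step (act E (n - 1) x) GenInv (Step (act E n x) Gen ?v))
     (Step (act E (n - 1) x) GenInv (power_walk E n x))"
    using assms by (intro homotopic_Step) auto
  moreover have "homotopic E (Step (act E (n - 1) x) GenInv (Step (act E n x) Gen ?v)) ?v"
    using cancel_inv_gen[of ?v] assms by simp
  ultimately show ?thesis
    by (meson homotopic.sym homotopic.trans)
qed

text \<open>Exponents of opposite sign cancel only up to homotopy, so \<open>m\<close> is moved away
  from 0 one step at a time in both directions. This gives the action law on the cover and the
  inverse of a power walk.\<close>

lemma power_walk_add:
  assumes "x \<in> points E"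
  shows "homotopic E (power_walk E (m + n) x) (power_walk E m (act E n x) \<odot> power_walk E n x)"
proof (induction m rule: int_induct[where k = 0])
  case base
  then show ?case using assms by (simp add: homotopic.refl)
next
  case (step1 i)
  let ?y = "act E n x" and ?z = "act E (i + 1 + n) x"
  have "homotopic E (power_walk E (i + 1 + n) x) (Step ?z Gen (power_walk E (i + n) x))"
    using power_walk_Gen[OF assms, of "i + n"] by (simp add: homotopic.sym algebra_simps)
  also have "homotopic E \<dots> (Step ?z Gen (power_walk E i ?y \<odot> power_walk E n x))"
    using assms step1 by (intro homotopic_Step) (auto simp: algebra_simps)
  also have "homotopic E \<dots> (power_walk E (i + 1) ?y \<odot> power_walk E n x)"
    using h5_right[OF power_walk_Gen[of ?y i], of "power_walk E n x"] assms
    by (simp add: algebra_simps)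
  finally show ?case .
next
  case (step2 i)
  let ?y = "act E n x" and ?z = "act E (i - 1 + n) x"
  have "homotopic E (power_walk E (i - 1 + n) x) (Step ?z GenInv (power_walk E (i + n) x))"
    using power_walk_GenInv[OF assms, of "i + n"] by (simp add: homotopic.sym algebra_simps)
  also have "homotopic E \<dots> (Step ?z GenInv (power_walk E i ?y \<odot> power_walk E n x))"
    using assms step2 by (intro homotopic_Step) (auto simp: algebra_simps)
  also have "homotopic E \<dots> (power_walk E (i - 1) ?y \<odot> power_walk E n x)"
    using h5_right[OF power_walk_GenInv[of ?y i], of "power_walk E n x"] assms
    by (simp add: algebra_simps)
  finally show ?case .
qed

text \<open>Compose on the left with the opposite power. This yields the directions of (f4) and (f5)
  that return from the shifted points to the original ones.\<close>

lemma power_walk_cancel: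
  assumes "is_walk E w" "is_walk E v" "target v = target w"
    and "homotopic E (power_walk E n (target w) \<odot> w) (power_walk E n (target w) \<odot> v)"
  shows "homotopic E w v"
proof -
  let ?p = "power_walk E n (target w)" and ?q = "power_walk E (- n) (act E n (target w))"
  have t: "target w \<in> points E"
    using assms target_in_points by blast
  \<comment> \<open>The exponents \<open>- n\<close> and \<open>n\<close> add up to 0, where the
    power walk is trivial.\<close>
  have qp: "homotopic E ((?q \<odot> ?p) \<odot> u) u" if "is_walk E u" "target u = target w" for u
    using h5_right[OF power_walk_add[OF t, of "- n" n] that(1)] t that by (simp add: homotopic.sym)
  have "homotopic E (?q \<odot> ?p \<odot> w) (?q \<odot> ?p \<odot> v)"
    using t assms(1-3) by (intro h5_left[OF assms(4)]) auto
  then show ?thesis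
    using qp[of w] qp[of v] assms unfolding walk_comp_assoc
    by (meson homotopic.sym homotopic.trans)
qed

section \<open>Reversal of walks\<close>

lemma is_walk_rev_walk: "is_walk E w \<Longrightarrow> is_walk E (rev_walk w)"
proof (induction w)
  case (Step x \<delta> w)
  then show ?case using target_in_points[of E w] by (cases \<delta>) auto
qed auto

lemma comp_rev_walk: "is_walk E w \<Longrightarrow> homotopic E (w \<odot> rev_walk w) (Triv (target w))"
proof (induction w)
  case (Triv x)
  then show ?case by (simp add: homotopic.refl)
next
  case (Step x \<delta> w)
  let ?y = "target w"
  have w: "is_walk E w" and y: "?y \<in> points E" and x: "x \<in> points E"
    using Step target_in_points by auto
  have adm: "admissible E x \<delta> ?y" and adm': "admissible E ?y (inv_letter \<delta>) x"
    using Step.prems y by (cases \<delta>; simp)+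
  let ?s = "Step ?y (inv_letter \<delta>) (Triv x)"
  \<comment> \<open>The reverse of the longer walk starts with the step \<open>?s\<close> back to
    the target of \<open>w\<close>; the part between the two outer steps contracts by induction, and
    then these two steps cancel.\<close>
  have "homotopic E ((w \<odot> rev_walk w) \<odot> ?s) (Triv ?y \<odot> ?s)"
    using Step.IH[OF w] x y adm' by (intro h5_right) (auto simp: w)
  then have "homotopic E (Step x \<delta> (w \<odot> rev_walk w \<odot> ?s)) (Step x \<delta> ?s)"
    using x adm by (intro homotopic_Step) (auto simp: walk_comp_assoc)
  also have "homotopic E (Step x \<delta> ?s) (Triv x)"
  proof (cases \<delta>)
    case Gen
    then show ?thesis using h1_gen_inv[of x] x adm' by simp
  next
    case GenInv
    then show ?thesis using h1_inv_gen[of x] x adm' by simp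
  next
    case Tau
    have "homotopic E (Step x Tau (Step ?y Tau (Triv x))) (Step x Tau (Triv x))"
      using x y adm Tau by (intro h2) auto
    also have "homotopic E \<dots> (Triv x)"
      using x by (rule h1_tau)
    finally show ?thesis using Tau by simp
  qed
  finally show ?case by simp
qed

text \<open>Composing on the right with the reverse of \<open>w\<close> turns \<open>w\<close> into
  a trivial walk on both sides.\<close>

lemma comp_right_cancel:
  assumes "is_walk E u" "is_walk E w" "target w = source u" "homotopic E (u \<odot> w) w"
  shows "homotopic E u (Triv (target w))"
proof -
  have r: "homotopic E (w \<odot> rev_walk w) (Triv (target w))"
    using assms(2) by (rule comp_rev_walk)
  have "homotopic E (u \<odot> w \<odot> rev_walk w) (u \<odot> Triv (target w))"
    using assms is_walk_rev_walk by (intro h5_left[OF r]) auto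
  then have "homotopic E u ((u \<odot> w) \<odot> rev_walk w)"
    using assms by (simp add: walk_comp_Triv walk_comp_assoc homotopic.sym)
  also have "homotopic E \<dots> (w \<odot> rev_walk w)"
    using assms is_walk_rev_walk by (intro h5_right[OF assms(4)]) auto
  also note r
  finally show ?thesis .
qed

section \<open>Homotopy classes and the fundamental group\<close>

lemma hclass_self: "is_walk E w \<Longrightarrow> w \<in> hclass E w"
  by (simp add: hclass_def homotopic.refl)

lemma hclass_eqI:
  assumes "homotopic E u v"
  shows "hclass E u = hclass E v"
proof -
  have "homotopic E u x \<longleftrightarrow> homotopic E v x" for x
    using homotopic.trans[OF assms] homotopic.trans[OF homotopic.sym[OF assms]] by blast
  then show ?thesis
    by (simp add: hclass_def)
qed

lemma hclass_eq_iff: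
  assumes "is_walk E u"
  shows "hclass E u = hclass E v \<longleftrightarrow> homotopic E u v"
proof
  assume "hclass E u = hclass E v"
  then have "homotopic E v u"
    using hclass_self[OF assms] by (simp add: hclass_def)
  then show "homotopic E u v"
    by (rule homotopic.sym)
qed (rule hclass_eqI)

text \<open>Operations on classes are unions over all representatives; once the value is seen to be
  independent of the representative, any one of them computes the union.\<close>

lemma UN_hclass:
  assumes "is_walk E w" "\<And>v. homotopic E w v \<Longrightarrow> F v = F w"
  shows "(\<Union>v\<in>hclass E w. F v) = F w"
  using assms(2) hclass_self[OF assms(1)] by (intro SUP_eq_const) (auto simp only: hclass_def)

lemma class_target_hclass [simp]: "is_walk E w \<Longrightarrow> class_target (hclass E w) = target w"
proof -
  assume w: "is_walk E w"
  have "target ` hclass E w = {target w}"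
    using hclass_self[OF w] by (auto simp: hclass_def dest: homotopic_target)
  then show ?thesis by (simp add: class_target_def)
qed

lemma class_tau_hclass:
  assumes "is_walk E w" "h \<in> points E" "P_class E h = P_class E (target w)"
  shows "class_tau E h (hclass E w) = hclass E (Step h Tau w)"
proof -
  have "hclass E (Step h Tau v) = hclass E (Step h Tau w)" if "homotopic E w v" for v
    using homotopic_Step[OF that, of h Tau] assms by (simp add: hclass_eqI)
  then show ?thesis
    using assms(1) by (simp add: class_tau_def UN_hclass)
qed

text \<open>The carrier collapses to the class of the trivial walk, so the group axioms reduce to a
  single product. No general proof that the fundamental group is a group is involved.\<close>

lemma trivial_fundamental_groupI:
  assumes "x \<in> points E"
    and "\<And>w. is_walk E w \<Longrightarrow> source w = x \<Longrightarrow> target w = x \<Longrightarrow> homotopic E w (Triv x)"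
  shows "trivial_group (fundamental_group E x)"
proof -
  let ?G = "fundamental_group E x" and ?I = "hclass E (Triv x)"
  have carrier: "carrier ?G = {?I}"
  proof (intro equalityI subsetI)
    show "W \<in> {?I}" if "W \<in> carrier ?G" for W
      using that assms(2) hclass_eqI by (auto simp: fundamental_group_def)
    show "W \<in> carrier ?G" if "W \<in> {?I}" for W
      using that assms(1) by (auto simp: fundamental_group_def intro!: exI[of _ "Triv x"])
  qed
  have *: "hclass E (u \<odot> v) = ?I" if "u \<in> ?I" "v \<in> ?I" for u v
    using that homotopic_comp[of "Triv x" u "Triv x" v] hclass_eqI unfolding hclass_def by force
  have "(\<Union>u\<in>?I. \<Union>v\<in>?I. hclass E (u \<odot> v)) = ?I"
    using * hclass_self[of "Triv x"] assms(1) by auto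
  then have mult: "?I \<otimes>\<^bsub>?G\<^esub> ?I = ?I"
    by (simp add: fundamental_group_def)
  have one: "\<one>\<^bsub>?G\<^esub> = ?I"
    by (simp add: fundamental_group_def)
  have "group ?G"
    by (rule groupI) (auto simp: carrier mult one)
  then show ?thesis
    by (simp add: trivial_group_def carrier one)
qed

end

section \<open>The universal cover\<close>

locale pointed_fBC = fBC E for E :: "'a brauer_config" +
  fixes e :: 'a
begin

abbreviation cover :: "'a walk set brauer_config" where
  "cover \<equiv> universal_cover E e"

section \<open>The cyclic group acting on the cover\<close>

lemma cover_simps [simp]:
  "points cover = cover_points E e" "act cover = cover_act E e"
  "P_part cover = cover_P E ` cover_points E e" "L_part cover = cover_L E ` cover_points E e"
  "deg cover = (\<lambda>W. deg E (class_target W))"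
  by (simp_all add: universal_cover_def)

lemma hclass_in_cover [simp]: "is_walk E w \<Longrightarrow> source w = e \<Longrightarrow> hclass E w \<in> cover_points E e"
  by (auto simp: cover_points_def)

lemma cover_pointsE:
  assumes "W \<in> cover_points E e"
  obtains w where "is_walk E w" "source w = e" "W = hclass E w"
  using assms by (auto simp: cover_points_def)

text \<open>Homotopic walks have the same target, hence are followed by the same power walk, and
  composition respects homotopy.\<close>

lemma cover_act_hclass:
  assumes "is_walk E w" "source w = e"
  shows "cover_act E e n (hclass E w) = hclass E (power_walk E n (target w) \<odot> w)"
proof -
  have "hclass E (power_walk E n (target v) \<odot> v) = hclass E (power_walk E n (target w) \<odot> w)"
    if "homotopic E w v" for v
    using homotopic_props[OF that] that assms target_in_points[of E w]
    by (intro hclass_eqI homotopic_comp) (auto intro: homotopic.refl homotopic.sym)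
  then show ?thesis
    using assms by (simp add: cover_act_def UN_hclass)
qed

lemma cover_act_1:
  assumes "is_walk E w" "source w = e"
  shows "cover_act E e 1 (hclass E w) = hclass E (Step (act E 1 (target w)) Gen w)"
    and "cover_act E e (-1) (hclass E w) = hclass E (Step (act E (-1) (target w)) GenInv w)"
  using assms by (simp_all add: cover_act_hclass power_walk_def)

lemma cover_act_add:
  assumes "W \<in> cover_points E e"
  shows "cover_act E e (m + n) W = cover_act E e m (cover_act E e n W)"
proof -
  obtain w where w: "is_walk E w" "source w = e" "W = hclass E w"
    using assms by (rule cover_pointsE)
  have "homotopic E (power_walk E (m + n) (target w) \<odot> w)
      ((power_walk E m (act E n (target w)) \<odot> power_walk E n (target w)) \<odot> w)"
    using w target_in_points[of E w] by (intro h5_right[OF power_walk_add]) auto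
  then show ?thesis
    using w target_in_points[of E w] by (simp add: cover_act_hclass hclass_eqI walk_comp_assoc)
qed

lemma cover_act_0: "W \<in> cover_points E e \<Longrightarrow> cover_act E e 0 W = W"
  by (elim cover_pointsE) (simp add: cover_act_hclass)

lemma cover_act_closed: "W \<in> cover_points E e \<Longrightarrow> cover_act E e n W \<in> cover_points E e"
  by (elim cover_pointsE) (simp add: cover_act_hclass target_in_points)

lemma class_target_cover_act:
  "W \<in> cover_points E e \<Longrightarrow> class_target (cover_act E e n W) = act E n (class_target W)"
  by (elim cover_pointsE) (simp add: cover_act_hclass target_in_points)

lemma class_target_in_points: "W \<in> cover_points E e \<Longrightarrow> class_target W \<in> points E"
  by (elim cover_pointsE) (simp add: target_in_points)

lemma cover_group_action: "group_action integer_group (points cover) (act cover)"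
proof -
  let ?A = "cover_points E e" and ?\<phi> = "cover_act E e"
  have bij: "?\<phi> n \<in> Bij ?A" for n
  proof -
    have "bij_betw (?\<phi> n) ?A ?A"
      by (rule bij_betw_byWitness[where f' = "?\<phi> (- n)"])
        (auto simp: cover_act_closed cover_act_0 simp flip: cover_act_add)
    then show ?thesis
      by (simp add: Bij_def cover_act_def)
  qed
  have "?\<phi> (m + n) = compose ?A (?\<phi> m) (?\<phi> n)" for m n
  proof
    fix W show "?\<phi> (m + n) W = compose ?A (?\<phi> m) (?\<phi> n) W"
    proof (cases "W \<in> ?A")
      \<comment> \<open>Outside the points of the cover both sides are \<open>undefined\<close>,
        since \<open>cover_act\<close> and \<open>compose\<close> are restricted functions.\<close>
      case False
      then show ?thesis by (simp add: cover_act_def compose_def)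
    qed (simp add: compose_eq cover_act_add)
  qed
  then have "?\<phi> \<in> hom integer_group (BijGroup ?A)"
    using bij by (auto simp: hom_def BijGroup_def)
  then have "group_hom integer_group (BijGroup ?A) ?\<phi>"
    by (simp add: group_hom_def group_hom_axioms_def group_BijGroup)
  then show ?thesis
    by (simp add: group_action_def)
qed

text \<open>
  The relation \<open>v \<sim> (t(v)|\<tau>|t(w)) w\<close> says that the classes of \<open>v\<close> and \<open>w\<close> lie in the same class of
  the partition of the cover; it contains \<open>P(t(v)) = P(t(w))\<close>, as only walks are homotopic.
\<close>

definition tau_related :: "'a walk \<Rightarrow> 'a walk \<Rightarrow> bool" where
  "tau_related v w \<longleftrightarrow> homotopic E v (Step (target v) Tau w)"

lemma tau_related_props:
  assumes "tau_related v w"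
  shows "is_walk E v" "is_walk E w" "source v = source w" "P_class E (target v) = P_class E (target w)"
  using homotopic_props[OF assms[unfolded tau_related_def]] by auto

lemma tau_related_refl: "is_walk E w \<Longrightarrow> tau_related w w"
  by (simp add: tau_related_def cancel_tau homotopic.sym)

text \<open>Two consecutive tau-steps merge into one by (h2).\<close>

lemma tau_related_trans:
  assumes "tau_related u v" "tau_related v w"
  shows "tau_related u w"
proof -
  note p = tau_related_props[OF assms(1)] tau_related_props[OF assms(2)]
  have "homotopic E u (Step (target u) Tau v)"
    using assms(1) by (simp add: tau_related_def)
  also have "homotopic E \<dots> (Step (target u) Tau (Step (target v) Tau w))"
    using assms(2) p target_in_points by (intro homotopic_Step) (auto simp: tau_related_def)
  also have "homotopic E \<dots> (Step (target u) Tau w)"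
    using p target_in_points by (intro tau_tau) auto
  finally show ?thesis by (simp add: tau_related_def)
qed

lemma tau_related_Step:
  assumes "is_walk E w" "x \<in> points E" "P_class E x = P_class E (target w)"
  shows "tau_related (Step x Tau w) w" "tau_related w (Step x Tau w)"
proof -
  show "tau_related (Step x Tau w) w"
    using assms by (simp add: tau_related_def homotopic.refl)
  have "homotopic E (Step (target w) Tau (Step x Tau w)) (Step (target w) Tau w)"
    using assms target_in_points by (intro tau_tau) auto
  also have "homotopic E \<dots> w"
    using assms(1) by (rule cancel_tau)
  finally show "tau_related w (Step x Tau w)"
    by (simp add: tau_related_def homotopic.sym)
qed

lemma tau_related_homotopic: "homotopic E u v \<Longrightarrow> tau_related u v"
  using homotopic_props[of u v] cancel_tau[of v]
  unfolding tau_related_def by (metis homotopic.sym homotopic.trans)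

text \<open>Pass through the walk \<open>Step (target v) Tau w\<close>: it is one tau-step away from
  \<open>w\<close> in either direction and homotopic to \<open>v\<close>.\<close>

lemma tau_related_sym:
  assumes "tau_related v w"
  shows "tau_related w v"
proof -
  have "tau_related w (Step (target v) Tau w)"
    using tau_related_props[OF assms] target_in_points by (intro tau_related_Step) auto
  moreover have "tau_related (Step (target v) Tau w) v"
    using assms by (intro tau_related_homotopic) (simp add: tau_related_def homotopic.sym)
  ultimately show ?thesis by (rule tau_related_trans)
qed

text \<open>The predicate \<open>Q\<close> treats both partitions at once: constantly true for P,
  membership in an L-class for L. The witness \<open>h\<close> is forced to be the target of
  \<open>v\<close>, because homotopic walks end at the same point.\<close>

lemma tau_related_hclass:
  assumes "is_walk E v" "is_walk E w"
  shows "(\<exists>h\<in>P_class E (target w). Q h \<and> hclass E v = hclass E (Step h Tau w))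
    \<longleftrightarrow> Q (target v) \<and> tau_related v w"
proof
  assume "\<exists>h\<in>P_class E (target w). Q h \<and> hclass E v = hclass E (Step h Tau w)"
  then obtain h where h: "Q h" "homotopic E v (Step h Tau w)"
    using assms hclass_eq_iff by auto
  then have "target v = h"
    using homotopic_target by fastforce
  with h show "Q (target v) \<and> tau_related v w"
    by (simp add: tau_related_def)
next
  assume "Q (target v) \<and> tau_related v w"
  then show "\<exists>h\<in>P_class E (target w). Q h \<and> hclass E v = hclass E (Step h Tau w)"
    using assms tau_related_props[of v w] P_eq_iff[of "target v" "target w"] target_in_points[of E v]
      target_in_points[of E w]
    by (intro bexI[of _ "target v"]) (auto simp: tau_related_def hclass_eqI)
qed

section \<open>The two partitions of the cover\<close>

lemma cover_P_eq:
  assumes "is_walk E w"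
  shows "cover_P E (hclass E w) = {hclass E (Step h Tau w) | h. h \<in> P_class E (target w)}"
proof -
  have "class_tau E h (hclass E w) = hclass E (Step h Tau w)" if "h \<in> P_class E (target w)" for h
    using that assms target_in_points[OF assms] P_mem P_eq_iff by (intro class_tau_hclass) blast+
  then show ?thesis
    using assms unfolding cover_P_def by auto
qed

text \<open>Membership in the P-class, supplied by (f1), is written out so that
  \<open>tau_related_hclass\<close> applies with \<open>Q\<close> as membership in the
  L-class.\<close>

lemma cover_L_eq:
  assumes "is_walk E w"
  shows "cover_L E (hclass E w) =
    {hclass E (Step h Tau w) | h. h \<in> P_class E (target w) \<and> h \<in> L_class E (target w)}"
proof -
  have L: "h \<in> P_class E (target w)" if "h \<in> L_class E (target w)" for h
    using that assms f1 target_in_points by blast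
  have "class_tau E h (hclass E w) = hclass E (Step h Tau w)" if "h \<in> P_class E (target w)" for h
    using that assms target_in_points[OF assms] P_mem P_eq_iff by (intro class_tau_hclass) blast+
  with L show ?thesis
    using assms unfolding cover_L_def by auto
qed

lemma hclass_in_cover_P:
  assumes "is_walk E v" "is_walk E w"
  shows "hclass E v \<in> cover_P E (hclass E w) \<longleftrightarrow> tau_related v w"
  using tau_related_hclass[OF assms, of "\<lambda>_. True"] unfolding cover_P_eq[OF assms(2)] by auto

lemma hclass_in_cover_L:
  assumes "is_walk E v" "is_walk E w"
  shows "hclass E v \<in> cover_L E (hclass E w)
    \<longleftrightarrow> L_class E (target v) = L_class E (target w) \<and> tau_related v w"
  using tau_related_hclass[OF assms, of "\<lambda>h. h \<in> L_class E (target w)"] assms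
    L_eq_iff[of "target v" "target w"] target_in_points[of E v] target_in_points[of E w]
  unfolding cover_L_eq[OF assms(2)] by auto

lemma cover_P_subset:
  assumes "W \<in> cover_points E e"
  shows "cover_P E W \<subseteq> cover_points E e"
proof -
  obtain w where w: "is_walk E w" "source w = e" "W = hclass E w"
    using assms by (rule cover_pointsE)
  have "is_walk E (Step h Tau w)" if "h \<in> P_class E (target w)" for h
    using that w target_in_points[of E w] P_mem P_eq_iff by simp blast
  then have "hclass E (Step h Tau w) \<in> cover_points E e" if "h \<in> P_class E (target w)" for h
    using that w by (intro hclass_in_cover) auto
  then show ?thesis
    using w by (auto simp: cover_P_eq)
qed

lemma cover_L_subset: "W \<in> cover_points E e \<Longrightarrow> cover_L E W \<subseteq> cover_P E W"
  by (elim cover_pointsE) (auto simp: cover_P_eq cover_L_eq)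

lemma cover_P_partition: "partition_on (points cover) (P_part cover)"
  unfolding cover_simps
proof (rule partition_on_classes)
  show "W \<in> cover_P E W" if "W \<in> cover_points E e" for W
    using that by (elim cover_pointsE) (simp add: hclass_in_cover_P tau_related_refl)
  show "cover_P E V = cover_P E W" if W: "W \<in> cover_points E e" and "V \<in> cover_P E W" for V W
  proof -
    have V: "V \<in> cover_points E e"
      using that cover_P_subset by blast
    have "U \<in> cover_P E V \<longleftrightarrow> U \<in> cover_P E W" if "U \<in> cover_points E e" for U
      using that V W \<open>V \<in> cover_P E W\<close>
      by (elim cover_pointsE) (auto simp: hclass_in_cover_P intro: tau_related_trans tau_related_sym)
    then show ?thesis using cover_P_subset V W by blast
  qed
qed (rule cover_P_subset)

lemma cover_L_partition: "partition_on (points cover) (L_part cover)"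
  unfolding cover_simps
proof (rule partition_on_classes)
  show "W \<in> cover_L E W" if "W \<in> cover_points E e" for W
    using that by (elim cover_pointsE) (simp add: hclass_in_cover_L tau_related_refl)
  show sub: "cover_L E W \<subseteq> cover_points E e" if "W \<in> cover_points E e" for W
    using that cover_P_subset cover_L_subset by blast
  show "cover_L E V = cover_L E W" if W: "W \<in> cover_points E e" and "V \<in> cover_L E W" for V W
  proof -
    have V: "V \<in> cover_points E e"
      using that sub by blast
    have "U \<in> cover_L E V \<longleftrightarrow> U \<in> cover_L E W" if "U \<in> cover_points E e" for U
      using that V W \<open>V \<in> cover_L E W\<close>
      by (elim cover_pointsE) (auto simp: hclass_in_cover_L intro: tau_related_trans tau_related_sym)
    then show ?thesis using sub V W by blast
  qed
qed

lemma P_class_cover: "W \<in> cover_points E e \<Longrightarrow> P_class cover W = cover_P E W"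
  using cover_P_partition
  by (intro part_class_eqI) (auto elim!: cover_pointsE simp: hclass_in_cover_P tau_related_refl)

lemma L_class_cover: "W \<in> cover_points E e \<Longrightarrow> L_class cover W = cover_L E W"
  using cover_L_partition
  by (intro part_class_eqI) (auto elim!: cover_pointsE simp: hclass_in_cover_L tau_related_refl)

text \<open>The axioms and the admissibility of tau-steps speak of equal classes in the cover; this
  translates such an equality into a homotopy in \<open>E\<close>.\<close>

lemma P_class_cover_eq_iff:
  assumes "is_walk E v" "source v = e" "is_walk E w" "source w = e"
  shows "P_class cover (hclass E v) = P_class cover (hclass E w) \<longleftrightarrow> tau_related v w"
  using part_class_eq_iff[OF cover_P_partition, of "hclass E v" "hclass E w"] assms
  by (simp add: P_class_cover[unfolded cover_simps] hclass_in_cover_P)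

lemma L_class_cover_eq_iff:
  assumes "is_walk E v" "source v = e" "is_walk E w" "source w = e"
  shows "L_class cover (hclass E v) = L_class cover (hclass E w)
    \<longleftrightarrow> L_class E (target v) = L_class E (target w) \<and> tau_related v w"
  using part_class_eq_iff[OF cover_L_partition, of "hclass E v" "hclass E w"] assms
  by (simp add: L_class_cover[unfolded cover_simps] hclass_in_cover_L)

text \<open>A point of the L-class upstairs is the class of \<open>w\<close> followed by a tau-step
  to some \<open>h\<close> in the L-class downstairs, and its target is that
  \<open>h\<close>.\<close>

lemma image_class_target_cover_L:
  assumes "W \<in> cover_points E e"
  shows "class_target ` cover_L E W = L_class E (class_target W)"
proof -
  obtain w where w: "is_walk E w" "source w = e" "W = hclass E w"
    using assms by (rule cover_pointsE)
  have t: "target w \<in> points E"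
    using w target_in_points by blast
  have LP: "L_class E (target w) \<subseteq> P_class E (target w)"
    using f1 t by blast
  have "class_target (hclass E (Step h Tau w)) = h" if "h \<in> L_class E (target w)" for h
  proof -
    have "is_walk E (Step h Tau w)"
      using that LP w t P_mem P_eq_iff by simp blast
    then show ?thesis by simp
  qed
  then have "(\<lambda>h. class_target (hclass E (Step h Tau w))) ` L_class E (target w) = L_class E (target w)"
    by simp
  moreover have "cover_L E W = (\<lambda>h. hclass E (Step h Tau w)) ` L_class E (target w)"
    using w LP by (auto simp: cover_L_eq)
  ultimately show ?thesis
    using w by (simp add: image_image)
qed

lemma map_L_sequence_cover:
  assumes "W \<in> cover_points E e"
  shows "map ((`) class_target) (L_sequence cover W) = L_sequence E (class_target W)"
  unfolding L_sequence_def
  using assms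
  by (simp add: L_class_cover[unfolded cover_simps] cover_act_closed image_class_target_cover_L
      class_target_cover_act)

text \<open>By (h3) the tau-step between the shifted walks can be moved in front of the powers; one
  direction then appends the power, the other cancels it.\<close>

lemma tau_related_act_deg:
  assumes "is_walk E v" "is_walk E w" "P_class E (target v) = P_class E (target w)"
  shows "tau_related (power_walk E (int (deg E (target v))) (target v) \<odot> v)
      (power_walk E (int (deg E (target w))) (target w) \<odot> w) \<longleftrightarrow> tau_related v w"
proof -
  let ?s = "target v" and ?t = "target w"
  let ?m = "int (deg E ?s)" and ?n = "int (deg E ?t)"
  have pts: "?s \<in> points E" "?t \<in> points E"
    using assms target_in_points by blast+
  \<comment> \<open>(h3) with \<open>e\<close> the target of \<open>w\<close> and \<open>h\<close>
    the target of \<open>v\<close>, preceded by \<open>w\<close>.\<close>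
  have "homotopic E (Step (act E ?m ?s) Tau (power_walk E ?n ?t) \<odot> w)
      ((power_walk E ?m ?s \<odot> Step ?s Tau (Triv ?t)) \<odot> w)"
    using pts assms by (intro h5_right[OF h3]) auto
  then have *: "homotopic E (Step (act E ?m ?s) Tau (power_walk E ?n ?t \<odot> w))
      (power_walk E ?m ?s \<odot> Step ?s Tau w)"
    by (simp add: walk_comp_assoc)
  show ?thesis
  proof
    assume "tau_related (power_walk E ?m ?s \<odot> v) (power_walk E ?n ?t \<odot> w)"
    then have "homotopic E (power_walk E ?m ?s \<odot> v) (Step (act E ?m ?s) Tau (power_walk E ?n ?t \<odot> w))"
      using pts by (simp add: tau_related_def)
    then have "homotopic E (power_walk E ?m ?s \<odot> v) (power_walk E ?m ?s \<odot> Step ?s Tau w)"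
      using * by (rule homotopic.trans)
    from power_walk_cancel[OF _ _ _ this] have "homotopic E v (Step ?s Tau w)"
      using assms pts by simp
    then show "tau_related v w" by (simp add: tau_related_def)
  next
    assume "tau_related v w"
    then have "homotopic E (power_walk E ?m ?s \<odot> v) (power_walk E ?m ?s \<odot> Step ?s Tau w)"
      using pts unfolding tau_related_def by (auto intro: h5_left)
    from homotopic.trans[OF this homotopic.sym[OF *]]
    show "tau_related (power_walk E ?m ?s \<odot> v) (power_walk E ?n ?t \<odot> w)"
      using pts by (simp add: tau_related_def)
  qed
qed

end

section \<open>The axioms of a fractional Brauer configuration for the cover\<close>

sublocale pointed_fBC \<subseteq> cover: fBC "universal_cover E e"
proof (intro fBC.intro fBC_axioms.intro cover_group_action cover_P_partition cover_L_partition)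
  fix W assume "W \<in> points cover"
  then show "0 < deg cover W"
    by (simp add: deg_pos class_target_in_points)
next
  fix W assume "W \<in> points cover"
  then have W: "W \<in> cover_points E e" by simp
  then have "finite (cover_P E W)"
    using f1[OF class_target_in_points] unfolding cover_P_def by simp
  then show "L_class cover W \<subseteq> P_class cover W \<and> finite (P_class cover W)"
    using W cover_L_subset L_class_cover P_class_cover by metis
next
  fix V W assume "V \<in> points cover" "W \<in> points cover" and eq: "L_class cover V = L_class cover W"
  then obtain v w where v: "is_walk E v" "source v = e" "V = hclass E v"
    and w: "is_walk E w" "source w = e" "W = hclass E w"
    by (metis cover_pointsE cover_simps(1))
  let ?s = "target v" and ?t = "target w"
  have pts: "?s \<in> points E" "?t \<in> points E"
    using v w target_in_points by blast+
  have L: "L_class E ?s = L_class E ?t" and vw: "tau_related v w"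
    using eq v w L_class_cover_eq_iff by auto
  have P: "P_class E (act E 1 ?s) = P_class E (act E 1 ?t)"
    using f2 pts L by blast
  \<comment> \<open>Replace \<open>v\<close> by \<open>w\<close> followed by a tau-step; (h4),
    applied after \<open>w\<close>, then moves that tau-step past \<open>g\<close>.\<close>
  have "homotopic E (Step (act E 1 ?s) Gen v) (Step (act E 1 ?s) Gen (Step ?s Tau w))"
    using vw pts by (intro homotopic_Step) (auto simp: tau_related_def)
  also have "homotopic E (Step (act E 1 ?s) Tau (Step (act E 1 ?t) Gen w))
     (Step (act E 1 ?s) Gen (Step ?s Tau w))"
    using h5_right[OF h4[where e = ?t and h = ?s], where w = w] pts L w by simp
  then have "homotopic E (Step (act E 1 ?s) Gen (Step ?s Tau w))
      (Step (act E 1 ?s) Tau (Step (act E 1 ?t) Gen w))"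
    by (rule homotopic.sym)
  finally have "tau_related (Step (act E 1 ?s) Gen v) (Step (act E 1 ?t) Gen w)"
    by (simp add: tau_related_def)
  then show "P_class cover (act cover 1 V) = P_class cover (act cover 1 W)"
    using v w pts P_class_cover_eq_iff[of "Step (act E 1 ?s) Gen v" "Step (act E 1 ?t) Gen w"]
    by (simp add: cover_act_1)
next
  fix V W assume "V \<in> points cover" and "W \<in> orbit integer_group (act cover) V"
  then obtain n where V: "V \<in> cover_points E e" and "W = cover_act E e n V"
    by (auto simp: orbit_def)
  then have "class_target W \<in> orbit integer_group (act E) (class_target V)"
    by (auto simp: orbit_def class_target_cover_act)
  then show "deg cover V = deg cover W"
    using f3 class_target_in_points[OF V] by simp
next
  fix V W assume "V \<in> points cover" "W \<in> points cover"
  then obtain v w where v: "is_walk E v" "source v = e" "V = hclass E v"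
    and w: "is_walk E w" "source w = e" "W = hclass E w"
    by (metis cover_pointsE cover_simps(1))
  let ?s = "target v" and ?t = "target w"
  let ?m = "int (deg E ?s)" and ?n = "int (deg E ?t)"
  let ?v = "power_walk E ?m ?s \<odot> v" and ?w = "power_walk E ?n ?t \<odot> w"
  have pts: "?s \<in> points E" "?t \<in> points E"
    using v w target_in_points by blast+
  have vw': "is_walk E ?v" "source ?v = e" "is_walk E ?w" "source ?w = e"
    "target ?v = act E ?m ?s" "target ?w = act E ?n ?t"
    using v w pts by auto
  have act: "act cover (int (deg cover V)) V = hclass E ?v"
    "act cover (int (deg cover W)) W = hclass E ?w"
    using v w by (simp_all add: cover_act_hclass)
  have tau: "tau_related v w \<longleftrightarrow> tau_related ?v ?w"
  proof (cases "P_class E ?s = P_class E ?t")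
    case True
    then show ?thesis using tau_related_act_deg v w by simp
  next
    case False
    then have "P_class E (target ?v) \<noteq> P_class E (target ?w)"
      using f4[OF pts] unfolding vw'(5,6) by blast
    with False show ?thesis
      using tau_related_props(4)[of v w] tau_related_props(4)[of ?v ?w] by blast
  qed
  show "P_class cover V = P_class cover W \<longleftrightarrow>
      P_class cover (act cover (int (deg cover V)) V) = P_class cover (act cover (int (deg cover W)) W)"
    unfolding act unfolding v(3) w(3)
    by (simp only: P_class_cover_eq_iff[OF v(1,2) w(1,2)] P_class_cover_eq_iff[OF vw'(1-4)] tau)
  \<comment> \<open>Equality of L-classes upstairs is \<open>tau_related\<close> together with
    equality of the L-classes of the targets; \<open>tau\<close> handles the first condition, (f5)
    of \<open>E\<close> the second.\<close>
  show "L_class cover V = L_class cover W \<longleftrightarrow>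
      L_class cover (act cover (int (deg cover V)) V) = L_class cover (act cover (int (deg cover W)) W)"
    unfolding act unfolding v(3) w(3)
    by (simp only: L_class_cover_eq_iff[OF v(1,2) w(1,2)] L_class_cover_eq_iff[OF vw'(1-4)] tau
        vw'(5,6) f5[OF pts, symmetric])
next
  fix V W assume "V \<in> points cover" "W \<in> points cover"
  then have VW: "V \<in> cover_points E e" "W \<in> cover_points E e" by simp_all
  show "\<not> strict_sublist (L_sequence cover V) (L_sequence cover W)"
  proof
    assume sub: "strict_sublist (L_sequence cover V) (L_sequence cover W)"
    let ?f = "map ((`) class_target)"
    \<comment> \<open>Projection may identify distinct L-classes of the cover, so strictness is
      carried by the length, which mapping preserves.\<close>
    have "length (L_sequence cover V) \<noteq> length (L_sequence cover W)"
      using sub unfolding strict_sublist_def sublist_def by auto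
    then have "?f (L_sequence cover V) \<noteq> ?f (L_sequence cover W)"
      by (metis length_map)
    then have "strict_sublist (?f (L_sequence cover V)) (?f (L_sequence cover W))"
      using sub unfolding strict_sublist_def by (simp add: map_mono_sublist)
    then show False
      using f6 VW class_target_in_points by (simp only: map_L_sequence_cover)
  qed
qed

section \<open>Lifting walks\<close>

text \<open>The lift starts at the class of \<open>w\<close>; the points it visits are the classes of the prefixes of \<open>u w\<close>.\<close>

primrec lift_walk :: "'a brauer_config \<Rightarrow> 'a walk \<Rightarrow> 'a walk \<Rightarrow> 'a walk set walk" where
  "lift_walk E w (Triv x) = Triv (hclass E w)"
| "lift_walk E w (Step x \<delta> u) = Step (hclass E (Step x \<delta> (u \<odot> w))) \<delta> (lift_walk E w u)"

lemma source_lift_walk [simp]: "source (lift_walk E w u) = hclass E w"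
  by (induction u) auto

lemma target_lift_walk [simp]: "target (lift_walk E w u) = hclass E (u \<odot> w)"
  by (cases u) auto

lemma lift_walk_comp: "lift_walk E w (u \<odot> v) = lift_walk E (v \<odot> w) u \<odot> lift_walk E w v"
  by (induction u) (auto simp: walk_comp_assoc)

context pointed_fBC
begin

text \<open>The points of a lift are classes, so only the class of the starting walk matters. This
  makes lifts composable when the first factor is replaced by a homotopic one.\<close>

lemma lift_walk_cong:
  assumes "homotopic E v w" "is_walk E u" "source u = target v"
  shows "lift_walk E v u = lift_walk E w u"
  using assms(2,3)
proof (induction u)
  case (Step x \<delta> u)
  then have "homotopic E (Step x \<delta> u \<odot> v) (Step x \<delta> u \<odot> w)"
    using homotopic_target[OF assms(1)] by (intro h5_left[OF assms(1)]) auto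
  then show ?case using Step by (simp add: hclass_eqI)
qed (simp add: hclass_eqI assms(1))

lemma is_walk_lift_walk:
  assumes "is_walk E w" "source w = e" "is_walk E u" "source u = target w"
  shows "is_walk cover (lift_walk E w u)"
  using assms(3,4)
proof (induction u)
  case (Step x \<delta> u)
  then have uw: "is_walk E (u \<odot> w)" "source (u \<odot> w) = e" "target (u \<odot> w) = target u"
    using assms by auto
  have "admissible cover (hclass E (Step x \<delta> (u \<odot> w))) \<delta> (hclass E (u \<odot> w))"
  proof (cases \<delta>)
    case Tau
    then have "tau_related (Step x \<delta> (u \<odot> w)) (u \<odot> w)"
      using Step.prems uw tau_related_Step(1)[of "u \<odot> w" x] by simp
    then show ?thesis
      using Step.prems uw Tau P_class_cover_eq_iff[of "Step x \<delta> (u \<odot> w)" "u \<odot> w"] by simp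
  qed (use Step.prems uw in \<open>simp_all add: cover_act_1\<close>)
  then show ?case
    using Step uw by simp
qed (simp add: assms)

text \<open>Lifts the two powers in (h3) to powers in the cover, so that the lifted relation has the
  shape of (h3) there.\<close>

lemma lift_power_walk:
  assumes "is_walk E w" "source w = e"
  shows "lift_walk E w (power_walk E n (target w)) = power_walk cover n (hclass E w)"
proof -
  have pos: "hclass E (pos_power_walk E k (target w) \<odot> w) = cover_act E e (int k) (hclass E w)"
    and neg: "hclass E (neg_power_walk E k (target w) \<odot> w) = cover_act E e (- int k) (hclass E w)" for k
    using assms by (cases k; simp add: cover_act_hclass power_walk_def nat_add_distrib)+
  have "lift_walk E w (pos_power_walk E k (target w)) = pos_power_walk cover k (hclass E w)" for k
    using pos[of "Suc k" for k] by (induction k) auto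
  moreover have "lift_walk E w (neg_power_walk E k (target w)) = neg_power_walk cover k (hclass E w)" for k
    using neg[of "Suc k" for k] by (induction k) auto
  ultimately show ?thesis
    by (simp add: power_walk_def)
qed

text \<open>Each generating relation lifts to the same relation of the cover once both lifts end at
  the same point, which is the relation in \<open>E\<close> applied after \<open>w\<close>. The
  start \<open>w\<close> has to vary: with a common first factor \<open>x\<close>, the induction
  hypothesis is used at \<open>x \<odot> w\<close>.\<close>

lemma lift_walk_homotopic:
  assumes "homotopic E u v" "is_walk E w" "source w = e" "source u = target w"
  shows "homotopic cover (lift_walk E w u) (lift_walk E w v)"
  using assms
proof (induction arbitrary: w rule: homotopic.induct)
  case (refl u)
  then show ?case by (intro homotopic.refl is_walk_lift_walk) auto
next
  case (sym u v)
  then show ?case using homotopic_source by (metis homotopic.sym)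
next
  case (trans u v x)
  then show ?case using homotopic_source by (metis homotopic.trans)
next
  case (h1_inv_gen x)
  then have "hclass E (Step x GenInv (Step (act E 1 x) Gen w)) = hclass E w"
    using cancel_inv_gen by (intro hclass_eqI) simp
  then show ?case
    using homotopic.h1_inv_gen[of "hclass E w" cover] h1_inv_gen by (simp add: cover_act_1)
next
  case (h1_gen_inv x)
  then have "hclass E (Step x Gen (Step (act E (-1) x) GenInv w)) = hclass E w"
    using cancel_gen_inv by (intro hclass_eqI) simp
  then show ?case
    using homotopic.h1_gen_inv[of "hclass E w" cover] h1_gen_inv by (simp add: cover_act_1)
next
  case (h1_tau x)
  then have "hclass E (Step x Tau w) = hclass E w"
    using cancel_tau by (intro hclass_eqI) simp
  then show ?case
    using homotopic.h1_tau[of "hclass E w" cover] h1_tau by simp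
next
  case (h2 x y z)
  have w: "is_walk E (Step y Tau w)" "is_walk E (Step z Tau (Step y Tau w))" "is_walk E (Step z Tau w)"
    using h2 by auto
  have "hclass E (Step z Tau (Step y Tau w)) = hclass E (Step z Tau w)"
    using h2 by (intro hclass_eqI tau_tau) auto
  moreover have "P_class cover (hclass E (Step y Tau w)) = P_class cover (hclass E w)"
    using h2 w tau_related_Step(1)[of w y] P_class_cover_eq_iff[of "Step y Tau w" w] by simp
  moreover have "P_class cover (hclass E (Step z Tau w)) = P_class cover (hclass E w)"
    using h2 w tau_related_Step(1)[of w z] P_class_cover_eq_iff[of "Step z Tau w" w] by simp
  ultimately show ?case
    using h2 w
      homotopic.h2[of "hclass E w" cover "hclass E (Step y Tau w)" "hclass E (Step z Tau w)"]
    by simp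
next
  case (h3 x y)
  let ?m = "int (deg E x)" and ?n = "int (deg E y)"
  let ?X = "hclass E w" and ?Y = "hclass E (Step y Tau w)"
  have x: "x = target w" using h3 by simp
  have w: "is_walk E (Step y Tau w)" "source (Step y Tau w) = e"
    using h3 by auto
  have P: "P_class cover ?X = P_class cover ?Y"
    using h3 w tau_related_Step(2)[of w y] P_class_cover_eq_iff[of w "Step y Tau w"] by simp
  have "homotopic E (Step (act E ?n y) Tau (power_walk E ?m x) \<odot> w)
      ((power_walk E ?n y \<odot> Step y Tau (Triv x)) \<odot> w)"
    using h3 by (intro h5_right[OF homotopic.h3]) auto
  \<comment> \<open>The end of the first lift is rewritten as the shift of \<open>?Y\<close>, the
    form that (h3) of the cover expects.\<close>
  then have top: "hclass E (Step (act E ?n y) Tau (power_walk E ?m x \<odot> w)) = cover_act E e ?n ?Y"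
    using w by (simp add: hclass_eqI walk_comp_assoc cover_act_hclass)
  have "lift_walk E w (Step (act E ?n y) Tau (power_walk E ?m x))
      = Step (act cover (int (deg cover ?Y)) ?Y) Tau (power_walk cover (int (deg cover ?X)) ?X)"
    using h3 w top lift_power_walk[of w ?m] by simp
  moreover have "lift_walk E w (power_walk E ?n y \<odot> Step y Tau (Triv x))
      = power_walk cover (int (deg cover ?Y)) ?Y \<odot> Step ?Y Tau (Triv ?X)"
    using h3 w lift_power_walk[of "Step y Tau w" ?n] by (simp add: lift_walk_comp)
  ultimately show ?case
    using homotopic.h3[of ?X cover ?Y] P h3 w by (simp del: cover_simps add: cover_simps(1))
next
  case (h4 x y)
  let ?X = "hclass E w" and ?Y = "hclass E (Step y Tau w)"
  have Pxy: "P_class E x = P_class E y"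
    using h4 L_eq_imp_P_eq by blast
  have w: "is_walk E (Step y Tau w)" "source (Step y Tau w) = e"
    using h4 Pxy by auto
  have L: "L_class cover ?X = L_class cover ?Y"
    using h4 w Pxy tau_related_Step(2)[of w y] L_class_cover_eq_iff[of w "Step y Tau w"] by simp
  have "homotopic E (Step (act E 1 y) Tau (Step (act E 1 x) Gen (Triv x)) \<odot> w)
      (Step (act E 1 y) Gen (Step y Tau (Triv x)) \<odot> w)"
    using h4 by (intro h5_right[OF homotopic.h4]) auto
  then have "hclass E (Step (act E 1 y) Tau (Step (act E 1 x) Gen w)) = cover_act E e 1 ?Y"
    using cover_act_1(1)[OF w] by (simp add: hclass_eqI)
  then show ?case
    using homotopic.h4[of ?X cover ?Y] L h4 w cover_act_1(1)[OF w] cover_act_1(1)[of w] by simp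
next
  case (h5_left u v x)
  have u: "is_walk E u" "is_walk E v" "source u = source v" "target u = target v"
    using homotopic_props[OF h5_left.hyps(1)] by auto
  have src: "source u = target w"
    using h5_left.prems h5_left.hyps by simp
  have uw: "homotopic E (u \<odot> w) (v \<odot> w)"
    using h5_left u src by (intro h5_right) auto
  \<comment> \<open>The common last factor \<open>x\<close> is lifted from two different walks,
    which are homotopic.\<close>
  have "lift_walk E (u \<odot> w) x = lift_walk E (v \<odot> w) x"
    using h5_left u src by (intro lift_walk_cong[OF uw]) auto
  moreover have "homotopic cover (lift_walk E (u \<odot> w) x \<odot> lift_walk E w u)
      (lift_walk E (u \<odot> w) x \<odot> lift_walk E w v)"
    using h5_left u src hclass_eqI[OF uw] is_walk_lift_walk[of "u \<odot> w" x]
    by (intro homotopic.h5_left) auto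
  ultimately show ?case
    by (simp add: lift_walk_comp)
next
  case (h5_right u v x)
  have src: "source x = target w"
    using h5_right.prems h5_right.hyps by simp
  show ?case
    unfolding lift_walk_comp
    using h5_right src is_walk_lift_walk[of w x]
    by (intro homotopic.h5_right) auto
qed

text \<open>Uniqueness of lifts: once the start and the earlier steps agree, a step by
  \<open>g\<close> or its inverse has a forced end, and the end of a tau-step is determined by its
  target in \<open>E\<close>.\<close>

lemma lift_project_walk:
  assumes "is_walk cover V" "is_walk E w" "source w = e" "source V = hclass E w"
  shows "is_walk E (map_walk class_target V)
    \<and> lift_walk E w (map_walk class_target V) = V"
  using assms(1,4)
proof (induction V)
  case (Triv X)
  then show ?case using assms by (simp add: target_in_points)
next
  case (Step X \<delta> V)
  let ?u = "map_walk class_target V"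
  have IH: "is_walk E ?u" "lift_walk E w ?u = V" and src: "source V = hclass E w"
    using Step by auto
  have srcu: "source ?u = target w"
    using src assms by simp
  have tV: "target V = hclass E (?u \<odot> w)"
    using IH(2) target_lift_walk by metis
  have uw: "is_walk E (?u \<odot> w)" "source (?u \<odot> w) = e" "target (?u \<odot> w) = target ?u"
    using IH srcu assms by auto
  obtain x where x: "is_walk E x" "source x = e" "X = hclass E x"
    using Step.prems by (auto elim: cover_pointsE)
  have adm: "admissible cover X \<delta> (hclass E (?u \<odot> w))"
    using Step.prems(1) unfolding tV[symmetric] by simp
  have "admissible E (target x) \<delta> (target ?u) \<and> X = hclass E (Step (target x) \<delta> (?u \<odot> w))"
  proof (cases \<delta>)
    case Gen
    then have X: "X = hclass E (Step (act E 1 (target ?u)) Gen (?u \<odot> w))"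
      using adm cover_act_1[OF uw(1,2)] uw(3) by simp
    have "is_walk E (Step (act E 1 (target ?u)) Gen (?u \<odot> w))"
      using uw target_in_points[OF uw(1)] by simp
    then have "target x = act E 1 (target ?u)"
      using class_target_hclass[OF x(1)] class_target_hclass X x(3) by (metis target.simps(2))
    with X show ?thesis using Gen by simp
  next
    case GenInv
    then have X: "X = hclass E (Step (act E (-1) (target ?u)) GenInv (?u \<odot> w))"
      using adm cover_act_1[OF uw(1,2)] uw(3) by simp
    have "is_walk E (Step (act E (-1) (target ?u)) GenInv (?u \<odot> w))"
      using uw target_in_points[OF uw(1)] by simp
    then have "target x = act E (-1) (target ?u)"
      using class_target_hclass[OF x(1)] class_target_hclass X x(3) by (metis target.simps(2))
    with X show ?thesis using GenInv by simp
  next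
    case Tau
    then have "tau_related x (?u \<odot> w)"
      using adm x uw P_class_cover_eq_iff[of x "?u \<odot> w"] by simp
    then show ?thesis
      using Tau x uw tau_related_props(4)[of x "?u \<odot> w"] by (simp add: tau_related_def hclass_eqI)
  qed
  moreover have "class_target X = target x"
    using x by simp
  ultimately show ?case
    using IH x(1) target_in_points[of E x] by simp
qed

text \<open>The class of the trivial walk at \<open>e\<close> serves as hub: the lift of
  \<open>w\<close> from there ends at the class of \<open>w\<close>. Two points are joined by going
  back to the hub and out again.\<close>

lemma cover_connected:
  assumes "e \<in> points E"
  shows "connected_config cover"
proof -
  have to: "\<exists>U. is_walk cover U \<and> source U = hclass E (Triv e) \<and> target U = W"
    if W: "W \<in> cover_points E e" for W
  proof -
    obtain w where w: "is_walk E w" "source w = e" "W = hclass E w"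
      using W by (rule cover_pointsE)
    then have "is_walk cover (lift_walk E (Triv e) w)"
      using assms by (intro is_walk_lift_walk) auto
    then show ?thesis
      using w by (intro exI[of _ "lift_walk E (Triv e) w"]) (simp add: walk_comp_Triv)
  qed
  show ?thesis
    unfolding connected_config_def
  proof (intro ballI)
    fix V W assume "V \<in> points cover" "W \<in> points cover"
    then obtain T U where "is_walk cover T" "source T = hclass E (Triv e)" "target T = V"
      and "is_walk cover U" "source U = hclass E (Triv e)" "target U = W"
      using to by (metis cover_simps(1))
    then show "\<exists>U. is_walk cover U \<and> source U = V \<and> target U = W"
      by (intro exI[of _ "U \<odot> rev_walk T"]) (simp add: cover.is_walk_rev_walk)
  qed
qed

lemma cover_closed_walk_null:
  assumes "is_walk cover V" "source V = W" "target V = W"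
  shows "homotopic cover V (Triv W)"
proof -
  obtain w where w: "is_walk E w" "source w = e" "W = hclass E w"
    using target_in_points[OF assms(1)] assms(3) by (auto elim: cover_pointsE)
  let ?u = "map_walk class_target V"
  have u: "is_walk E ?u" "lift_walk E w ?u = V"
    using lift_project_walk[of V w] assms w by auto
  have src: "target w = source ?u"
    using assms w by simp
  \<comment> \<open>The end of \<open>V\<close>, read off from the lift, is the class of
    \<open>?u \<odot> w\<close>; as \<open>V\<close> is closed, it is also the class of
    \<open>w\<close>.\<close>
  have "hclass E (?u \<odot> w) = hclass E w"
    using u(2) assms(3) w(3) target_lift_walk by metis
  then have "homotopic E (?u \<odot> w) w"
    using u w src by (subst (asm) hclass_eq_iff) auto
  then have "homotopic E ?u (Triv (target w))"
    using u w src comp_right_cancel by metis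
  then have "homotopic cover (lift_walk E w ?u) (lift_walk E w (Triv (target w)))"
    using w src by (intro lift_walk_homotopic) auto
  then show ?thesis using u w by simp
qed

end

theorem proposition3p23:
  fixes E :: "'a brauer_config" and e :: 'a
  assumes "fBC E"
    and "e \<in> points E"
  shows "simply_connected_fBC (universal_cover E e)"
proof -
  interpret pointed_fBC E e
    using assms(1) by (simp add: pointed_fBC_def)
  show ?thesis
    unfolding simply_connected_fBC_def
    using cover.fBC_axioms cover_connected assms(2) cover_closed_walk_null
      cover.trivial_fundamental_groupI by blast
qed

end
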